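(* Let $I$ be a directed set and let $(X_i,\mathcal{B}_i,\mu_i,\pi_{ij})$ be a convergent diagram in $\mathfrak{M}$ indexed by $I$, with limit $(X_\infty,\mathcal{B}_\infty,\mu_\infty,\pi_i)$. For every $f\in L^1(X_\infty,\mu_\infty)$ there exists $(f_i)_{i\in I}\in\prod_{i\in I}L^1(X_i,\mu_i)$ such that $$\int_{X_\infty}f\,\mathrm{d}\mu_\infty=\lim_{i\in I}\int_{X_i}f_i\,\mathrm{d}\mu_i,$$ where the limit is a limit of nets. Moreover, one can choose $f_i=[\pi_i^*]^{-1}(\mathbb{E}_i(f))$ for each $i\in I$.
   Context: A directed set is a nonempty set $I$ with a reflexive and transitive relation $\le$ such that any two elements have a common upper bound. $\mathfrak{M}$ is the category of probability spaces and measure preserving measurable maps. A diagram in $\mathfrak{M}$ indexed by $I$ is a family $(X_i,\mathcal{B}_i,\mu_i,\pi_{ij})$ of probability spaces and measure preserving maps $\pi_{ij}:X_j\to X_i$ for $i\le j$ (i.e. $(\pi_{ij})_*\mu_j=\mu_i$), with $\pi_{ii}=\mathrm{id}$ and $\pi_{ik}=\pi_{ij}\circ\pi_{jk}$ for $i\le j\le k$. Put $X_\infty=\{(x_i)_{i}\in\prod_{i\in I}X_i:\pi_{ij}(x_j)=x_i\text{ for all }i\le j\}$, let $\pi_j:X_\infty\to X_j$ be the coordinate projections, and $\mathcal{B}_\infty=\sigma(\{\pi_i^{-1}(B):B\in\mathcal{B}_i,\ i\in I\})$. The diagram is convergent if there is a measure $\mu_\infty$ on $(X_\infty,\mathcal{B}_\infty)$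 with $(\pi_i)_*\mu_\infty=\mu_i$ for every $i$; then $(X_\infty,\mathcal{B}_\infty,\mu_\infty,\pi_i)$ is its limit. $L^1$ denotes spaces of real-valued functions, and $\pi_i^*:L^1(X_i,\mu_i)\to L^1(X_\infty,\mu_\infty)$, $\pi_i^*(u)=u\circ\pi_i$, a linear isometry. $\mathbb{E}_i(f)=\mathbb{E}[f\,|\,\mathcal{B}^i]$ is the conditional expectation with respect to $\mathcal{B}^i=\{\pi_i^{-1}(B):B\in\mathcal{B}_i\}$; it lies in the range of $\pi_i^*$, so $[\pi_i^*]^{-1}(\mathbb{E}_i(f))$ makes sense. *)

theory Defs
  imports "HOL-Probability.Probability"
begin

section \<open>Directed sets and nets\<close>

definition directed_set :: "'i set \<Rightarrow> ('i \<Rightarrow> 'i \<Rightarrow> bool) \<Rightarrow> bool" where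
  "directed_set I le \<longleftrightarrow>
     I \<noteq> {} \<and>
     (\<forall>i\<in>I. le i i) \<and>
     (\<forall>i\<in>I. \<forall>j\<in>I. \<forall>k\<in>I. le i j \<longrightarrow> le j k \<longrightarrow> le i k) \<and>
     (\<forall>i\<in>I. \<forall>j\<in>I. \<exists>k\<in>I. le i k \<and> le j k)"

definition net_filter :: "'i set \<Rightarrow> ('i \<Rightarrow> 'i \<Rightarrow> bool) \<Rightarrow> 'i filter" where
  "net_filter I le = (INF i\<in>I. principal {j \<in> I. le i j})"

lemma eventually_net_filter:
  assumes "directed_set I le"
  shows "eventually P (net_filter I le) \<longleftrightarrow> (\<exists>i\<in>I. \<forall>j\<in>I. le i j \<longrightarrow> P j)"
proof -
  have "eventually P (net_filter I le) \<longleftrightarrow>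
      (\<exists>i\<in>I. eventually P (principal {j \<in> I. le i j}))"
    unfolding net_filter_def
  proof (rule eventually_INF_base)
    show "I \<noteq> {}" using assms by (simp add: directed_set_def)
    fix a b assume "a \<in> I" "b \<in> I"
    then obtain c where c: "c \<in> I" "le a c" "le b c"
      using assms unfolding directed_set_def by blast
    then have "{j \<in> I. le c j} \<subseteq> {j \<in> I. le a j} \<inter> {j \<in> I. le b j}"
      using assms \<open>a \<in> I\<close> \<open>b \<in> I\<close> unfolding directed_set_def by blast
    then show "\<exists>x\<in>I. principal {j \<in> I. le x j}
        \<le> inf (principal {j \<in> I. le a j}) (principal {j \<in> I. le b j})"
      using c by auto
  qed
  then show ?thesis by (auto simp: eventually_principal)
qed


section \<open>Diagrams of probability spaces and their limits\<close>

definition measure_preserving_maps :: "'a measure \<Rightarrow> 'b measure \<Rightarrow> ('a \<Rightarrow> 'b) set" where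
  "measure_preserving_maps M N = {p \<in> measurable M N. distr M N p = N}"

definition prob_diagram ::
  "'i set \<Rightarrow> ('i \<Rightarrow> 'i \<Rightarrow> bool) \<Rightarrow> ('i \<Rightarrow> 'a measure) \<Rightarrow> ('i \<Rightarrow> 'i \<Rightarrow> 'a \<Rightarrow> 'a) \<Rightarrow> bool" where
  "prob_diagram I le M \<pi> \<longleftrightarrow>
     (\<forall>i\<in>I. prob_space (M i)) \<and>
     (\<forall>i\<in>I. \<forall>j\<in>I. le i j \<longrightarrow> \<pi> i j \<in> measure_preserving_maps (M j) (M i)) \<and>
     (\<forall>i\<in>I. \<forall>x\<in>space (M i). \<pi> i i x = x) \<and>
     (\<forall>i\<in>I. \<forall>j\<in>I. \<forall>k\<in>I. le i j \<longrightarrow> le j k \<longrightarrow>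
        (\<forall>x\<in>space (M k). \<pi> i k x = \<pi> i j (\<pi> j k x)))"

definition limit_space ::
  "'i set \<Rightarrow> ('i \<Rightarrow> 'i \<Rightarrow> bool) \<Rightarrow> ('i \<Rightarrow> 'a measure) \<Rightarrow> ('i \<Rightarrow> 'i \<Rightarrow> 'a \<Rightarrow> 'a) \<Rightarrow> ('i \<Rightarrow> 'a) set" where
  "limit_space I le M \<pi> =
     {x \<in> (\<Pi>\<^sub>E i\<in>I. space (M i)). \<forall>i\<in>I. \<forall>j\<in>I. le i j \<longrightarrow> \<pi> i j (x j) = x i}"

definition limit_sets ::
  "'i set \<Rightarrow> ('i \<Rightarrow> 'i \<Rightarrow> bool) \<Rightarrow> ('i \<Rightarrow> 'a measure) \<Rightarrow> ('i \<Rightarrow> 'i \<Rightarrow> 'a \<Rightarrow> 'a) \<Rightarrow> ('i \<Rightarrow> 'a) set set" where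
  "limit_sets I le M \<pi> =
     sigma_sets (limit_space I le M \<pi>)
       (\<Union>i\<in>I. {(\<lambda>x. x i) -` B \<inter> limit_space I le M \<pi> | B. B \<in> sets (M i)})"

definition diagram_limit ::
  "'i set \<Rightarrow> ('i \<Rightarrow> 'i \<Rightarrow> bool) \<Rightarrow> ('i \<Rightarrow> 'a measure) \<Rightarrow> ('i \<Rightarrow> 'i \<Rightarrow> 'a \<Rightarrow> 'a) \<Rightarrow>
     ('i \<Rightarrow> 'a) measure \<Rightarrow> bool" where
  "diagram_limit I le M \<pi> N \<longleftrightarrow>
     space N = limit_space I le M \<pi> \<and>
     sets N = limit_sets I le M \<pi> \<and>
     (\<forall>i\<in>I. (\<lambda>x. x i) \<in> measure_preserving_maps N (M i))"

definition convergent_diagram ::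
  "'i set \<Rightarrow> ('i \<Rightarrow> 'i \<Rightarrow> bool) \<Rightarrow> ('i \<Rightarrow> 'a measure) \<Rightarrow> ('i \<Rightarrow> 'i \<Rightarrow> 'a \<Rightarrow> 'a) \<Rightarrow> bool" where
  "convergent_diagram I le M \<pi> \<longleftrightarrow>
     prob_diagram I le M \<pi> \<and> (\<exists>N. diagram_limit I le M \<pi> N)"


section \<open>The space \<open>L\<^sup>1\<close> of almost-everywhere classes\<close>

definition L1_rel :: "'a measure \<Rightarrow> (('a \<Rightarrow> real) \<times> ('a \<Rightarrow> real)) set" where
  "L1_rel M = {(f, g). integrable M f \<and> integrable M g \<and> (AE x in M. f x = g x)}"

definition L1 :: "'a measure \<Rightarrow> ('a \<Rightarrow> real) set set" where
  "L1 M = {f. integrable M f} // L1_rel M"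

definition L1_integral :: "'a measure \<Rightarrow> ('a \<Rightarrow> real) set \<Rightarrow> real" where
  "L1_integral M u = the_elem ((\<lambda>f. integral\<^sup>L M f) ` u)"

definition L1_pullback :: "'a measure \<Rightarrow> ('a \<Rightarrow> 'b) \<Rightarrow> ('b \<Rightarrow> real) set \<Rightarrow> ('a \<Rightarrow> real) set" where
  "L1_pullback N p u = (\<Union>f\<in>u. L1_rel N `` {f \<circ> p})"

definition L1_cond_exp :: "'a measure \<Rightarrow> 'a measure \<Rightarrow> ('a \<Rightarrow> real) set \<Rightarrow> ('a \<Rightarrow> real) set" where
  "L1_cond_exp N F u = (\<Union>f\<in>u. L1_rel N `` {real_cond_exp N F f})"

lemma equiv_L1_rel: "equiv {f. integrable M f} (L1_rel M)"
proof (rule equivI)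
  show "trans (L1_rel M)"
    unfolding L1_rel_def by (rule transI) (auto elim: AE_mp)
qed (auto simp: L1_rel_def refl_on_def sym_def eq_commute)

lemma L1_integral_class:
  assumes "integrable M f"
  shows "L1_integral M (L1_rel M `` {f}) = integral\<^sup>L M f"
proof -
  have "(\<lambda>f. integral\<^sup>L M f) ` (L1_rel M `` {f}) = {integral\<^sup>L M f}"
    using assms by (auto simp: L1_rel_def image_iff intro!: integral_cong_AE)
  then show ?thesis by (simp add: L1_integral_def)
qed

lemma L1_pullback_class:
  assumes p: "p \<in> measure_preserving_maps N M" and f: "integrable M f"
  shows "L1_pullback N p (L1_rel M `` {f}) = L1_rel N `` {f \<circ> p}"
proof -
  have m: "p \<in> measurable N M" and d: "distr N M p = M"
    using p by (auto simp: measure_preserving_maps_def)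
  have "(f \<circ> p, g \<circ> p) \<in> L1_rel N" if "(f, g) \<in> L1_rel M" for g
  proof -
    from that have "AE x in distr N M p. f x = g x" "integrable (distr N M p) f"
        "integrable (distr N M p) g"
      unfolding d by (auto simp: L1_rel_def)
    then have "AE x in N. f (p x) = g (p x)" "integrable N (\<lambda>x. f (p x))"
        "integrable N (\<lambda>x. g (p x))"
      using AE_distrD[OF m] integrable_distr[OF m] by auto
    then show ?thesis by (simp add: L1_rel_def o_def)
  qed
  then have "L1_rel N `` {g \<circ> p} = L1_rel N `` {f \<circ> p}" if "(f, g) \<in> L1_rel M" for g
    using that equiv_class_eq[OF equiv_L1_rel] by metis
  moreover have "(f, f) \<in> L1_rel M" using f by (simp add: L1_rel_def)
  ultimately show ?thesis unfolding L1_pullback_def by blast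
qed

lemma inj_on_L1_pullback:
  assumes p: "p \<in> measure_preserving_maps N M"
  shows "inj_on (L1_pullback N p) (L1 M)"
proof (rule inj_onI)
  fix u v assume "u \<in> L1 M" "v \<in> L1 M" and eq: "L1_pullback N p u = L1_pullback N p v"
  then obtain f g where f: "integrable M f" "u = L1_rel M `` {f}"
    and g: "integrable M g" "v = L1_rel M `` {g}"
    by (auto simp: L1_def elim!: quotientE)
  have m: "p \<in> measurable N M" and d: "distr N M p = M"
    using p by (auto simp: measure_preserving_maps_def)
  have "integrable N (g \<circ> p)"
    using integrable_distr[OF m, of g] g d by (simp add: o_def)
  then have "(f \<circ> p, g \<circ> p) \<in> L1_rel N"
    using eq f g eq_equiv_class[OF _ equiv_L1_rel] by (simp add: L1_pullback_class[OF p])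
  then have "AE x in N. f (p x) = g (p x)" by (simp add: L1_rel_def)
  moreover have "{x \<in> space M. f x = g x} \<in> sets M"
    using f g by measurable
  ultimately have "AE x in distr N M p. f x = g x"
    by (simp add: AE_distr_iff[OF m])
  then have "AE x in M. f x = g x" unfolding d .
  then have "(f, g) \<in> L1_rel M" using f g by (simp add: L1_rel_def)
  then show "u = v" using f g equiv_class_eq[OF equiv_L1_rel] by metis
qed

lemma L1_cond_exp_class:
  assumes F: "sigma_finite_subalgebra N F" and f: "integrable N f"
  shows "L1_cond_exp N F (L1_rel N `` {f}) = L1_rel N `` {real_cond_exp N F f}"
proof -
  interpret sigma_finite_subalgebra N F by fact
  have "(real_cond_exp N F f, real_cond_exp N F g) \<in> L1_rel N" if "(f, g) \<in> L1_rel N" for g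
    using that real_cond_exp_cong[of f g] by (auto simp: L1_rel_def real_cond_exp_int)
  then have "L1_rel N `` {real_cond_exp N F g} = L1_rel N `` {real_cond_exp N F f}"
    if "(f, g) \<in> L1_rel N" for g
    using that equiv_class_eq[OF equiv_L1_rel] by metis
  moreover have "(f, f) \<in> L1_rel N" using f by (simp add: L1_rel_def)
  ultimately show ?thesis unfolding L1_cond_exp_def by blast
qed


section \<open>The canonical family\<close>

text \<open>\<^term>\<open>vimage_algebra (space N) (\<lambda>x. x i) (M i)\<close> is generated by the preimages of measurable
  sets under the \<open>i\<close>-th projection, which already form a \<open>\<sigma>\<close>-algebra.\<close>

definition level_cond_exp ::
  "('i \<Rightarrow> 'a measure) \<Rightarrow> ('i \<Rightarrow> 'a) measure \<Rightarrow> 'i \<Rightarrow> (('i \<Rightarrow> 'a) \<Rightarrow> real) set \<Rightarrow>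
     (('i \<Rightarrow> 'a) \<Rightarrow> real) set" where
  "level_cond_exp M N i f = L1_cond_exp N (vimage_algebra (space N) (\<lambda>x. x i) (M i)) f"

end

theory Submission
  imports Defs
begin

text \<open>
  No approximation is involved: the net of integrals is constant. Conditional expectation and
  composition with a measure-preserving map both preserve integrals, so the function \<open>f\<^sub>i\<close> on
  \<open>X\<^sub>i\<close> that represents \<open>E\<^sub>i(f)\<close> satisfies
  \<open>\<integral> f\<^sub>i d\<mu>\<^sub>i = \<integral> E\<^sub>i(f) d\<mu>\<^sub>\<infinity> = \<integral> f d\<mu>\<^sub>\<infinity>\<close> at every index \<open>i\<close>.

  The substance lies in the existence of \<open>f\<^sub>i\<close>, that is, in the fact that \<open>E\<^sub>i(f)\<close> lies in the range
  of the pullback along the projection. This is the Doob--Dynkin factorization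
  (\<open>measurable_vimage_algebra_factor_real\<close>): a function that is measurable for the \<open>\<sigma>\<close>-algebra
  generated by a map is a measurable function of that map. Its combination with the two integral
  identities is \<open>L1_cond_exp_pullback\<close>, which is applied to one projection at a time.
\<close>

text \<open>The map need not be surjective and its image need not be measurable, so the factor cannot be
  defined pointwise on the image and then extended by \<open>0\<close>. Induction over measurable functions
  avoids this: in the limit step the supremum of the factors is measurable on the whole target
  space. Values in \<^typ>\<open>ennreal\<close> make that supremum exist off the image, where the factors need
  not be monotone or bounded.\<close>

lemma measurable_vimage_algebra_factor:
  fixes u :: "'a \<Rightarrow> ennreal"
  assumes p: "p \<in> X \<rightarrow> space M"
    and u: "u \<in> borel_measurable (vimage_algebra X p M)"
  shows "\<exists>g \<in> borel_measurable M. \<forall>x\<in>X. u x = g (p x)"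
  using u
proof (induction rule: borel_measurable_induct)
  case (cong f g)
  then show ?case by auto
next
  case (set A)
  then obtain B where B: "B \<in> sets M" "A = p -` B \<inter> X"
    using p by (auto simp: sets_vimage_algebra2)
  show ?case
    by (rule bexI[of _ "indicator B"]) (use B in \<open>auto simp: indicator_def\<close>)
next
  case (mult u c)
  then obtain g where "g \<in> borel_measurable M" "\<forall>x\<in>X. u x = g (p x)" by blast
  then show ?case by (intro bexI[of _ "\<lambda>y. c * g y"]) auto
next
  case (add u v)
  then obtain g h where "g \<in> borel_measurable M" "\<forall>x\<in>X. u x = g (p x)"
    "h \<in> borel_measurable M" "\<forall>x\<in>X. v x = h (p x)" by blast
  then show ?case by (intro bexI[of _ "\<lambda>y. h y + g y"]) auto
next
  case (seq U)
  then obtain g where "\<And>i. g i \<in> borel_measurable M" "\<And>i. \<forall>x\<in>X. U i x = g i (p x)"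
    by metis
  then show ?case by (intro bexI[of _ "\<lambda>y. SUP i. g i y"]) (auto simp: image_comp)
qed

lemma measurable_vimage_algebra_factor_real:
  fixes u :: "'a \<Rightarrow> real"
  assumes p: "p \<in> X \<rightarrow> space M"
    and u: "u \<in> borel_measurable (vimage_algebra X p M)"
  shows "\<exists>g \<in> borel_measurable M. \<forall>x\<in>X. u x = g (p x)"
proof -
  have "(\<lambda>x. ennreal (u x)) \<in> borel_measurable (vimage_algebra X p M)"
    "(\<lambda>x. ennreal (- u x)) \<in> borel_measurable (vimage_algebra X p M)"
    using u by measurable
  then obtain g h where [measurable]: "g \<in> borel_measurable M" "h \<in> borel_measurable M"
    and gh: "\<forall>x\<in>X. ennreal (u x) = g (p x)" "\<forall>x\<in>X. ennreal (- u x) = h (p x)"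
    using measurable_vimage_algebra_factor[OF p] by metis
  have "u x = enn2real (g (p x)) - enn2real (h (p x))" if "x \<in> X" for x
    using gh[THEN bspec, OF that, symmetric] by (cases "0 \<le> u x") (auto simp: ennreal_neg)
  then show ?thesis
    by (intro bexI[of _ "\<lambda>y. enn2real (g y) - enn2real (h y)"]) auto
qed

lemma measure_preserving_sigma_finite_subalgebra:
  assumes p: "p \<in> measure_preserving_maps N M" and N: "finite_measure N"
  shows "sigma_finite_subalgebra N (vimage_algebra (space N) p M)"
proof -
  interpret finite_measure N by fact
  have m: "p \<in> measurable N M" using p by (simp add: measure_preserving_maps_def)
  have "subalgebra N (vimage_algebra (space N) p M)"
    using m by (auto simp: subalgebra_def sets_vimage_algebra2 measurable_space)
  then show ?thesis
    by (intro finite_measure_subalgebra_is_sigma_finite) unfold_locales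
qed

text \<open>The image of \<open>u\<close> under \<open>[p\<^sup>*]\<^sup>-\<^sup>1 \<circ> E[- | p]\<close> exists in \<open>L\<^sup>1\<close> and has the same integral
  as \<open>u\<close>; uniqueness is the injectivity of the pullback.\<close>

lemma L1_cond_exp_pullback:
  assumes p: "p \<in> measure_preserving_maps N M" and N: "finite_measure N" and u: "u \<in> L1 N"
  shows "\<exists>v \<in> L1 M. L1_pullback N p v = L1_cond_exp N (vimage_algebra (space N) p M) u \<and>
    L1_integral M v = L1_integral N u"
proof -
  let ?F = "vimage_algebra (space N) p M"
  have m: "p \<in> measurable N M" and d: "distr N M p = M"
    using p by (auto simp: measure_preserving_maps_def)
  have sf: "sigma_finite_subalgebra N ?F"
    by (rule measure_preserving_sigma_finite_subalgebra[OF p N])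
  interpret sigma_finite_subalgebra N ?F by fact
  obtain f where f: "integrable N f" "u = L1_rel N `` {f}"
    using u by (auto simp: L1_def elim!: quotientE)
  let ?h = "real_cond_exp N ?F f"
  have h: "integrable N ?h" "(\<integral>x. ?h x \<partial>N) = (\<integral>x. f x \<partial>N)"
    using real_cond_exp_int[OF f(1)] by auto
  obtain g where g[measurable]: "g \<in> borel_measurable M"
    and hg: "\<And>x. x \<in> space N \<Longrightarrow> ?h x = g (p x)"
    using measurable_vimage_algebra_factor_real[of p "space N" M ?h] measurable_space[OF m]
      borel_measurable_cond_exp[of N ?F f] by auto
  have gp: "integrable N (g \<circ> p)"
    using h(1) by (simp add: o_def hg cong: Bochner_Integration.integrable_cong)
  have gi: "integrable M g"
    using gp integrable_distr_eq[OF m g] d by (simp add: o_def)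
  have "(\<integral>y. g y \<partial>M) = (\<integral>y. g y \<partial>distr N M p)" by (simp add: d)
  also have "\<dots> = (\<integral>x. g (p x) \<partial>N)" by (rule integral_distr[OF m g])
  also have "\<dots> = (\<integral>x. ?h x \<partial>N)"
    by (rule Bochner_Integration.integral_cong) (simp_all add: hg)
  finally have int: "(\<integral>y. g y \<partial>M) = (\<integral>x. f x \<partial>N)" using h(2) by simp
  have "(g \<circ> p, ?h) \<in> L1_rel N"
    using gp h(1) by (simp add: L1_rel_def hg)
  then have "L1_rel N `` {g \<circ> p} = L1_rel N `` {?h}"
    by (rule equiv_class_eq[OF equiv_L1_rel])
  then have "L1_pullback N p (L1_rel M `` {g}) = L1_cond_exp N ?F u"
    using L1_pullback_class[OF p gi] L1_cond_exp_class[OF sf f(1)] f(2) by simp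
  moreover have "L1_rel M `` {g} \<in> L1 M"
    using gi by (auto simp: L1_def intro: quotientI)
  moreover have "L1_integral M (L1_rel M `` {g}) = L1_integral N u"
    using L1_integral_class[OF gi] L1_integral_class[OF f(1)] int f(2) by simp
  ultimately show ?thesis by blast
qed

theorem mainTheorem4:
  fixes I :: "'i set" and le :: "'i \<Rightarrow> 'i \<Rightarrow> bool"
    and M :: "'i \<Rightarrow> 'a measure" and \<pi> :: "'i \<Rightarrow> 'i \<Rightarrow> 'a \<Rightarrow> 'a"
    and N :: "('i \<Rightarrow> 'a) measure" and f :: "(('i \<Rightarrow> 'a) \<Rightarrow> real) set"
  assumes "directed_set I le"
    and "convergent_diagram I le M \<pi>"
    and "diagram_limit I le M \<pi> N"
    and "f \<in> L1 N"
  shows "(\<exists>g \<in> (\<Pi>\<^sub>E i\<in>I. L1 (M i)).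
            ((\<lambda>i. L1_integral (M i) (g i)) \<longlongrightarrow> L1_integral N f) (net_filter I le)) \<and>
         (\<exists>g \<in> (\<Pi>\<^sub>E i\<in>I. L1 (M i)).
            (\<forall>i\<in>I. level_cond_exp M N i f \<in> L1_pullback N (\<lambda>x. x i) ` L1 (M i) \<and>
                    g i = the_inv_into (L1 (M i)) (L1_pullback N (\<lambda>x. x i)) (level_cond_exp M N i f)) \<and>
            ((\<lambda>i. L1_integral (M i) (g i)) \<longlongrightarrow> L1_integral N f) (net_filter I le))"
proof -
  let ?p = "\<lambda>i (x :: 'i \<Rightarrow> 'a). x i"
  have p: "?p i \<in> measure_preserving_maps N (M i)" if "i \<in> I" for i
    using assms(3) that by (simp add: diagram_limit_def)
  have "finite_measure N" if "i \<in> I" for i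
  proof -
    have "prob_space (M i)"
      using assms(2) that by (simp add: convergent_diagram_def prob_diagram_def)
    then have "prob_space N"
      using p[OF that] by (intro prob_space_distrD[of "?p i" N "M i"])
        (auto simp: measure_preserving_maps_def)
    then show ?thesis by (rule prob_space.finite_measure)
  qed
  then have "\<exists>v \<in> L1 (M i). L1_pullback N (?p i) v = level_cond_exp M N i f \<and>
      L1_integral (M i) v = L1_integral N f" if "i \<in> I" for i
    using L1_cond_exp_pullback[OF p[OF that] _ assms(4)] that by (simp add: level_cond_exp_def)
  then obtain v where v: "\<And>i. i \<in> I \<Longrightarrow> v i \<in> L1 (M i)"
    "\<And>i. i \<in> I \<Longrightarrow> L1_pullback N (?p i) (v i) = level_cond_exp M N i f"
    "\<And>i. i \<in> I \<Longrightarrow> L1_integral (M i) (v i) = L1_integral N f"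
    by metis
  define g where "g = restrict v I"
  have g: "g \<in> (\<Pi>\<^sub>E i\<in>I. L1 (M i))"
    using v(1) by (auto simp: g_def)
  have "level_cond_exp M N i f \<in> L1_pullback N (?p i) ` L1 (M i) \<and>
      g i = the_inv_into (L1 (M i)) (L1_pullback N (?p i)) (level_cond_exp M N i f)"
    if "i \<in> I" for i
  proof
    show "level_cond_exp M N i f \<in> L1_pullback N (?p i) ` L1 (M i)"
      using v(1,2)[OF that] by (metis image_eqI)
    show "g i = the_inv_into (L1 (M i)) (L1_pullback N (?p i)) (level_cond_exp M N i f)"
      using the_inv_into_f_eq[OF inj_on_L1_pullback[OF p[OF that]] v(2)[OF that] v(1)[OF that]]
        that by (simp add: g_def)
  qed
  moreover have "((\<lambda>i. L1_integral (M i) (g i)) \<longlongrightarrow> L1_integral N f) (net_filter I le)"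
  proof (rule tendsto_eventually)
    obtain i where "i \<in> I" using assms(1) by (auto simp: directed_set_def)
    then show "\<forall>\<^sub>F i in net_filter I le. L1_integral (M i) (g i) = L1_integral N f"
      using v(3) by (auto simp: eventually_net_filter[OF assms(1)] g_def)
  qed
  ultimately show ?thesis using g by blast
qed

end
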